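(* Let $G=(V,E)$ be a connected undirected graph with $n=|V|$, $m=|E|$, root $r\in V$ and edge weights $w_e>0$, and let $r_{\max}=\max_{e,e'\in E}w_e/w_{e'}$. Then the expected number of random variables drawn by the cycle-popping algorithm on $G$ (including the initial draws) is at most $(n-1)+2r_{\max}mn$.
   Context: Cycle-popping: for each vertex $v\neq r$ independently choose a neighbour $\sigma(v)$, where neighbour $u$ is chosen with probability proportional to $w_{\{u,v\}}$ (one random variable per non-root vertex). While the digraph with arcs $v\to\sigma(v)$ contains a directed cycle, find all its directed cycles $C_1,\dots,C_k$ and independently re-draw $\sigma(v)$ (with the same distribution) for every vertex $v$ on some $C_i$. Output the subgraph induced by the final $\sigma$, which is a spanning tree $T$ chosen with probability proportional to $\prod_{e\in T}w_e$. *)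

theory Defs
  imports "HOL-Probability.Probability" "Graph_Theory.Graph_Theory"
begin

text \<open>
  A finite simple undirected graph is a finite vertex set \<open>V\<close> together with a set \<open>E\<close> of
  two-element subsets of \<open>V\<close>; edge weights are a function on edges.
\<close>

definition simple_graph :: "'a set \<Rightarrow> 'a set set \<Rightarrow> bool" where
  "simple_graph V E \<longleftrightarrow> finite V \<and> (\<forall>e\<in>E. e \<subseteq> V \<and> card e = 2)"

definition sym_digraph_of :: "'a set \<Rightarrow> 'a set set \<Rightarrow> 'a pair_pre_digraph" where
  "sym_digraph_of V E = \<lparr> pverts = V, parcs = {(u, v). {u, v} \<in> E} \<rparr>"

definition connected_graph :: "'a set \<Rightarrow> 'a set set \<Rightarrow> bool" where
  "connected_graph V E \<longleftrightarrow> Digraph_Component.connected (with_proj (sym_digraph_of V E))"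

text \<open>Unspecified (\<open>Max {}\<close>) when \<open>E\<close> is empty.\<close>

definition weight_ratio :: "'a set set \<Rightarrow> ('a set \<Rightarrow> real) \<Rightarrow> real" where
  "weight_ratio E w = Max {w e / w e' | e e'. e \<in> E \<and> e' \<in> E}"

definition neighbours :: "'a set set \<Rightarrow> 'a \<Rightarrow> 'a set" where
  "neighbours E v = {u. {u, v} \<in> E}"

text \<open>
  \<open>embed_pmf\<close> yields the intended distribution only if the given masses sum to one, which
  is the case exactly when \<open>v\<close> has a neighbour; see \<open>pmf_neighbour_pmf\<close> below.
\<close>

definition neighbour_pmf :: "'a set set \<Rightarrow> ('a set \<Rightarrow> real) \<Rightarrow> 'a \<Rightarrow> 'a pmf" where
  "neighbour_pmf E w v = embed_pmf (\<lambda>u.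
     if u \<in> neighbours E v then w {u, v} / (\<Sum>x\<in>neighbours E v. w {x, v}) else 0)"

text \<open>
  The digraph with arcs \<open>v \<rightarrow> \<sigma> v\<close>, and the set of all vertices lying on one of its directed
  cycles. Directed cycles of length two count as cycles.
\<close>

definition choice_digraph :: "'a set \<Rightarrow> 'a \<Rightarrow> ('a \<Rightarrow> 'a) \<Rightarrow> 'a pair_pre_digraph" where
  "choice_digraph V r \<sigma> = \<lparr> pverts = V, parcs = {(v, \<sigma> v) | v. v \<in> V - {r}} \<rparr>"

definition cycle_vertices :: "'a set \<Rightarrow> 'a \<Rightarrow> ('a \<Rightarrow> 'a) \<Rightarrow> 'a set" where
  "cycle_vertices V r \<sigma> =
     {v. \<exists>p. pre_digraph.cycle (with_proj (choice_digraph V r \<sigma>)) p \<and> v \<in> fst ` set p}"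

text \<open>
  The randomness is an independent family \<open>\<omega> (t, v)\<close>, \<open>t\<close> a natural number and \<open>v\<close> a
  non-root vertex, where \<open>\<omega> (t, v)\<close> is the value obtained if \<open>\<sigma> v\<close> is drawn in round \<open>t\<close>.
  Round \<open>0\<close> is the initial draw of all \<open>\<sigma> v\<close>; in round \<open>t + 1\<close> exactly the vertices on
  directed cycles of the configuration after round \<open>t\<close> are re-drawn. Entries that the algorithm
  never looks at are not counted. Once there is no cycle, no vertex is drawn any more, so
  the terminated algorithm is the constant continuation; a non-terminating run has
  infinitely many draws.
\<close>

definition draw_space ::
    "'a set \<Rightarrow> 'a set set \<Rightarrow> ('a set \<Rightarrow> real) \<Rightarrow> 'a \<Rightarrow> (nat \<times> 'a \<Rightarrow> 'a) measure" where
  "draw_space V E w r =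
     (\<Pi>\<^sub>M (t, v) \<in> UNIV \<times> (V - {r}). measure_pmf (neighbour_pmf E w v))"

primrec config :: "'a set \<Rightarrow> 'a \<Rightarrow> (nat \<times> 'a \<Rightarrow> 'a) \<Rightarrow> nat \<Rightarrow> 'a \<Rightarrow> 'a" where
  "config V r \<omega> 0 = (\<lambda>v. \<omega> (0, v))"
| "config V r \<omega> (Suc t) =
     (\<lambda>v. if v \<in> cycle_vertices V r (config V r \<omega> t) then \<omega> (Suc t, v)
          else config V r \<omega> t v)"

primrec drawn_vertices :: "'a set \<Rightarrow> 'a \<Rightarrow> (nat \<times> 'a \<Rightarrow> 'a) \<Rightarrow> nat \<Rightarrow> 'a set" where
  "drawn_vertices V r \<omega> 0 = V - {r}"
| "drawn_vertices V r \<omega> (Suc t) = cycle_vertices V r (config V r \<omega> t)"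

definition num_draws :: "'a set \<Rightarrow> 'a \<Rightarrow> (nat \<times> 'a \<Rightarrow> 'a) \<Rightarrow> ennreal" where
  "num_draws V r \<omega> = (\<Sum>t. of_nat (card (drawn_vertices V r \<omega> t)))"

definition expected_draws ::
    "'a set \<Rightarrow> 'a set set \<Rightarrow> ('a set \<Rightarrow> real) \<Rightarrow> 'a \<Rightarrow> ennreal" where
  "expected_draws V E w r = (\<integral>\<^sup>+ \<omega>. num_draws V r \<omega> \<partial>draw_space V E w r)"

text \<open>
  The remaining facts confirm that \<open>neighbour_pmf\<close> is the intended distribution and that
  \<open>num_draws\<close> is a random variable, so that the integral above is its expectation.
\<close>

lemma pmf_neighbour_pmf:
  assumes "simple_graph V E" "\<And>e. e \<in> E \<Longrightarrow> w e > 0" "neighbours E v \<noteq> {}"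
  shows "pmf (neighbour_pmf E w v) u =
    (if u \<in> neighbours E v then w {u, v} / (\<Sum>x\<in>neighbours E v. w {x, v}) else 0)"
proof -
  let ?N = "neighbours E v" and ?S = "\<Sum>x\<in>neighbours E v. w {x, v}"
  have fin: "finite ?N"
    by (rule finite_subset[of _ V]) (use assms(1) in \<open>auto simp: simple_graph_def neighbours_def\<close>)
  have pos: "x \<in> ?N \<Longrightarrow> w {x, v} > 0" for x
    using assms(2) by (auto simp: neighbours_def)
  have S: "?S > 0"
    using fin assms(3) pos by (intro sum_pos) auto
  let ?f = "\<lambda>u. if u \<in> ?N then w {u, v} / ?S else 0"
  have nn: "?f u \<ge> 0" for u
    using pos[of u] S by (auto intro!: divide_nonneg_nonneg)
  have "(\<integral>\<^sup>+ u. ennreal (?f u) \<partial>count_space UNIV) = (\<integral>\<^sup>+ u. ennreal (?f u) \<partial>count_space ?N)"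
    by (intro nn_integral_count_space_eq) auto
  also have "\<dots> = (\<Sum>u\<in>?N. ennreal (?f u))"
    using fin by (rule nn_integral_count_space_finite)
  also have "\<dots> = ennreal (\<Sum>u\<in>?N. ?f u)"
    using nn by (intro sum_ennreal)
  also have "(\<Sum>u\<in>?N. ?f u) = (\<Sum>u\<in>?N. w {u, v} / ?S)"
    by (intro sum.cong) auto
  also have "\<dots> = 1"
    using S by (simp flip: sum_divide_distrib)
  finally show ?thesis
    unfolding neighbour_pmf_def using nn by (subst pmf_embed_pmf) auto
qed

lemma prob_space_draw_space: "prob_space (draw_space V E w r)"
  unfolding draw_space_def
  by (intro prob_space_PiM) (auto simp: measure_pmf.prob_space_axioms split: prod.splits)

lemma cycle_choice_digraph:
  assumes "pre_digraph.cycle (with_proj (choice_digraph V r \<sigma>)) p"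
  shows "set p \<subseteq> {(a, b). a \<in> V - {r} \<and> b \<in> V - {r} \<and> \<sigma> a = b}"
proof -
  from assms obtain u where u: "u \<in> V" "set p \<subseteq> {(v, \<sigma> v) | v. v \<in> V - {r}}" "pcas u p u" "p \<noteq> []"
    by (auto simp: pre_digraph.cycle_def pre_digraph.awalk_def cas_with_proj_eq choice_digraph_def)
  have heads: "pcas a q b \<Longrightarrow> snd ` set q \<subseteq> insert b (fst ` set q)" for a b :: 'a and q
    by (induction q arbitrary: a)
      (auto simp: image_iff intro: rev_bexI,
       metis (no_types, lifting) fst_conv list.set_intros(1) pcas.elims(2))
  have "u \<in> fst ` set p"
    using u(3,4) by (cases p) auto
  with heads[OF u(3)] have "snd ` set p \<subseteq> fst ` set p" by auto
  with u(2) show ?thesis by fastforce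
qed

lemma cycle_vertices_subset: "cycle_vertices V r \<sigma> \<subseteq> V - {r}"
  unfolding cycle_vertices_def using cycle_choice_digraph by fastforce

lemma cycle_vertices_cong:
  assumes "{(a, b). a \<in> V - {r} \<and> b \<in> V - {r} \<and> \<sigma> a = b} =
    {(a, b). a \<in> V - {r} \<and> b \<in> V - {r} \<and> \<tau> a = b}"
  shows "cycle_vertices V r \<sigma> = cycle_vertices V r \<tau>"
proof -
  have "pre_digraph.cycle (with_proj (choice_digraph V r \<beta>)) p"
    if eq: "{(a, b). a \<in> V - {r} \<and> b \<in> V - {r} \<and> \<alpha> a = b} =
        {(a, b). a \<in> V - {r} \<and> b \<in> V - {r} \<and> \<beta> a = b}"
      and c: "pre_digraph.cycle (with_proj (choice_digraph V r \<alpha>)) p" for \<alpha> \<beta> p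
  proof -
    have "set p \<subseteq> parcs (choice_digraph V r \<beta>)"
      using cycle_choice_digraph[OF c] unfolding eq by (auto simp: choice_digraph_def)
    with c show ?thesis
      by (auto simp: pre_digraph.cycle_def pre_digraph.awalk_def cas_with_proj_eq
          awalk_verts_with_proj_eq choice_digraph_def)
  qed
  from this[OF assms] this[OF assms[symmetric]] show ?thesis
    unfolding cycle_vertices_def by blast
qed

lemma measurable_cycle_vertices:
  assumes fin: "finite V"
    and meas: "\<And>v. v \<in> V - {r} \<Longrightarrow> (\<lambda>\<omega>. f \<omega> v) \<in> measurable M (count_space UNIV)"
  shows "(\<lambda>\<omega>. cycle_vertices V r (f \<omega>)) \<in> measurable M (count_space UNIV)"
proof -
  define W where "W = V - {r}"
  define A where "A \<sigma> = {(a, b). a \<in> W \<and> b \<in> W \<and> \<sigma> a = b}" for \<sigma> :: "'a \<Rightarrow> 'a"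
  define c where "c B = cycle_vertices V r (SOME \<sigma>. A \<sigma> = B)" for B
  have c: "c (A \<sigma>) = cycle_vertices V r \<sigma>" for \<sigma>
  proof -
    have "A (SOME \<tau>. A \<tau> = A \<sigma>) = A \<sigma>" by (rule someI[of "\<lambda>\<tau>. A \<tau> = A \<sigma>" \<sigma>]) (rule refl)
    then show ?thesis
      unfolding c_def A_def W_def by (rule cycle_vertices_cong)
  qed
  have finW: "finite W" using fin by (simp add: W_def)
  have "(\<lambda>\<omega>. A (f \<omega>)) \<in> measurable M (count_space (Pow (W \<times> W)))"
  proof (subst measurable_count_space_eq2)
    show "finite (Pow (W \<times> W))" using finW by simp
    show "(\<lambda>\<omega>. A (f \<omega>)) \<in> space M \<rightarrow> Pow (W \<times> W) \<and>
      (\<forall>B\<in>Pow (W \<times> W). (\<lambda>\<omega>. A (f \<omega>)) -` {B} \<inter> space M \<in> sets M)"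
    proof (intro conjI ballI)
      show "(\<lambda>\<omega>. A (f \<omega>)) \<in> space M \<rightarrow> Pow (W \<times> W)" by (auto simp: A_def)
      fix B assume B: "B \<in> Pow (W \<times> W)"
      have "(\<lambda>\<omega>. A (f \<omega>)) -` {B} \<inter> space M =
          {\<omega> \<in> space M. \<forall>a\<in>W. \<forall>b\<in>W. (f \<omega> a = b) = ((a, b) \<in> B)}"
        using B by (auto simp: A_def)
      also have "\<dots> \<in> sets M"
      proof (intro sets.sets_Collect_finite_All finW)
        fix a b assume "a \<in> W" "b \<in> W"
        then have fa: "(\<lambda>\<omega>. f \<omega> a) \<in> measurable M (count_space UNIV)"
          using meas by (simp add: W_def)
        have "(\<lambda>\<omega>. f \<omega> a) -` {x. (x = b) = ((a, b) \<in> B)} \<inter> space M \<in> sets M"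
          using fa by (rule measurable_sets) simp
        then show "{\<omega> \<in> space M. (f \<omega> a = b) = ((a, b) \<in> B)} \<in> sets M"
          by (auto simp: vimage_def Int_def conj_commute)
      qed
      finally show "(\<lambda>\<omega>. A (f \<omega>)) -` {B} \<inter> space M \<in> sets M" .
    qed
  qed
  then have "(\<lambda>\<omega>. c (A (f \<omega>))) \<in> measurable M (count_space UNIV)"
    by (rule measurable_compose) simp
  then show ?thesis by (simp add: c)
qed

lemma measurable_config:
  assumes "finite V" "v \<in> V - {r}"
  shows "(\<lambda>\<omega>. config V r \<omega> t v) \<in> measurable (draw_space V E w r) (count_space UNIV)"
proof -
  have draw: "(\<lambda>\<omega>. \<omega> (t, v)) \<in> measurable (draw_space V E w r) (count_space UNIV)"
    if "v \<in> V - {r}" for t v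
  proof -
    have "(\<lambda>\<omega>. \<omega> (t, v)) \<in> measurable (draw_space V E w r) (measure_pmf (neighbour_pmf E w v))"
      unfolding draw_space_def
      using measurable_component_singleton[of "(t, v)" "UNIV \<times> (V - {r})"
          "\<lambda>(t, v). measure_pmf (neighbour_pmf E w v)"] that by simp
    then show ?thesis by simp
  qed
  show ?thesis
    using assms(2)
  proof (induction t arbitrary: v)
    case 0
    then show ?case using draw by simp
  next
    case (Suc t)
    let ?M = "draw_space V E w r"
    have cyc: "(\<lambda>\<omega>. cycle_vertices V r (config V r \<omega> t)) \<in> measurable ?M (count_space UNIV)"
      using assms(1) Suc.IH by (rule measurable_cycle_vertices)
    have "(\<lambda>\<omega>. cycle_vertices V r (config V r \<omega> t)) -` {S. v \<in> S} \<inter> space ?M \<in> sets ?M"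
      using cyc by (rule measurable_sets) simp
    then have "{\<omega> \<in> space ?M. v \<in> cycle_vertices V r (config V r \<omega> t)} \<in> sets ?M"
      by (auto simp: vimage_def Int_def conj_commute)
    with draw[OF Suc.prems, of "Suc t"] Suc.IH[OF Suc.prems] show ?case
      unfolding config.simps by (intro measurable_If) auto
  qed
qed

lemma borel_measurable_num_draws:
  assumes "finite V"
  shows "num_draws V r \<in> borel_measurable (draw_space V E w r)"
proof -
  let ?M = "draw_space V E w r"
  have "(\<lambda>\<omega>. drawn_vertices V r \<omega> t) \<in> measurable ?M (count_space UNIV)" for t
    using measurable_cycle_vertices[OF assms measurable_config[OF assms]] by (cases t) auto
  then have "(\<lambda>\<omega>. of_nat (card (drawn_vertices V r \<omega> t)) :: ennreal) \<in> borel_measurable ?M" for t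
    by (rule measurable_compose) simp
  then show ?thesis
    unfolding num_draws_def[abs_def] by (rule borel_measurable_suminf_order)
qed

end

theory Submission
  imports Defs
begin

text \<open>
  Let \<open>h v\<close> be the expected time at which the random walk with the law of the draws, started at
  \<open>v\<close>, hits \<open>r\<close>, so that \<open>h v\<close> exceeds the mean of \<open>h\<close> over a random draw of \<open>\<sigma> v\<close> by exactly one.
  Consider the potential \<open>\<Sum>v\<noteq>r. h v - h (\<sigma> v)\<close>. A directed cycle contributes zero to it by
  telescoping, so re-drawing the vertices of a cycle raises its mean by the number of vertices
  re-drawn: the mean potential after round \<open>t\<close> is the expected number of draws up to round \<open>t\<close>.
  On the other hand the potential is bounded. Regard \<open>w {u, v} (h v - h u)\<close> as a flow; every
  vertex \<open>x \<noteq> r\<close> is a source of strength equal to its weighted degree, so the flow through an edge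
  \<open>{u, v}\<close> with \<open>h u < h v\<close> is at most the flow leaving the set \<open>{x. h v \<le> h x}\<close>, hence at most the
  sum \<open>2 \<Sum>e. w e\<close> of all weighted degrees.
\<close>

section \<open>Permutation of the cycle vertices\<close>

text \<open>The heads of the arcs of a closed walk are the same vertices as the tails, and
  \<open>\<sigma>\<close> sends each tail to its head.\<close>

lemma image_cycle_vertices: "\<sigma> ` cycle_vertices V r \<sigma> = cycle_vertices V r \<sigma>"
proof -
  have *: "\<sigma> ` fst ` set p = fst ` set p"
    if c: "pre_digraph.cycle (with_proj (choice_digraph V r \<sigma>)) p" for p
  proof -
    from c obtain u where u: "pcas u p u" "p \<noteq> []"
      by (auto simp: pre_digraph.cycle_def pre_digraph.awalk_def cas_with_proj_eq choice_digraph_def)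
    \<comment> \<open>Heads and tails of a walk can differ only at its two ends. For the closed walk
      at \<open>u\<close> both insertions are absorbed, since \<open>u\<close> is a tail and a
      head.\<close>
    have ends: "pcas a q b \<Longrightarrow> insert a (snd ` set q) = insert b (fst ` set q)" for a b :: 'a and q
      by (induction q arbitrary: a) auto
    have "u \<in> fst ` set p"
      using u by (cases p) auto
    moreover have "pcas a q b \<Longrightarrow> q \<noteq> [] \<Longrightarrow> b \<in> snd ` set q" for a b :: 'a and q
      by (induction q arbitrary: a) (auto, metis pcas.simps(1))
    then have "u \<in> snd ` set p"
      using u by blast
    ultimately have "snd ` set p = fst ` set p"
      using ends[OF u(1)] by (simp only: insert_absorb)
    moreover have "\<sigma> ` fst ` set p = snd ` set p"
      unfolding image_image using cycle_choice_digraph[OF c] by (intro image_cong) auto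
    ultimately show ?thesis by simp
  qed
  have "cycle_vertices V r \<sigma> =
      (\<Union>p\<in>{p. pre_digraph.cycle (with_proj (choice_digraph V r \<sigma>)) p}. fst ` set p)"
    unfolding cycle_vertices_def by blast
  then show ?thesis
    using * by (simp add: image_UN)
qed

text \<open>A map of a finite set onto itself permutes it, so both halves of the sum agree. Hence
  the values discarded by popping have total potential zero.\<close>

lemma sum_cycle_vertices:
  fixes h :: "'a \<Rightarrow> real"
  assumes "finite V"
  shows "(\<Sum>v\<in>cycle_vertices V r \<sigma>. h v - h (\<sigma> v)) = 0"
proof -
  let ?C = "cycle_vertices V r \<sigma>"
  have "finite ?C"
    using cycle_vertices_subset assms by (metis finite_Diff finite_subset)
  then have "inj_on \<sigma> ?C"
    using image_cycle_vertices[of \<sigma> V r] by (simp add: eq_card_imp_inj_on)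
  then have "(\<Sum>v\<in>?C. h (\<sigma> v)) = sum h (\<sigma> ` ?C)"
    by (simp add: sum.reindex)
  then show ?thesis
    by (simp add: image_cycle_vertices sum_subtractf)
qed

section \<open>Configurations and fresh draws\<close>

lemma cycle_vertices_eqI:
  assumes "\<And>v. v \<in> V - {r} \<Longrightarrow> \<sigma> v = \<tau> v"
  shows "cycle_vertices V r \<sigma> = cycle_vertices V r \<tau>"
  by (rule cycle_vertices_cong) (use assms in auto)

text \<open>A configuration depends only on draws of rounds up to \<open>t\<close>; this is what
  makes it independent of the draws of round \<open>Suc t\<close>.\<close>

lemma config_restrict:
  assumes "v \<in> V - {r}" "{..t} \<times> (V - {r}) \<subseteq> J"
  shows "config V r (restrict \<omega> J) t v = config V r \<omega> t v"
  using assms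
proof (induction t arbitrary: v)
  case (Suc t)
  have "{..t} \<times> (V - {r}) \<subseteq> {..Suc t} \<times> (V - {r})"
    by auto
  with Suc.prems(2) have "{..t} \<times> (V - {r}) \<subseteq> J"
    by (rule order_trans[rotated])
  then have "config V r (restrict \<omega> J) t u = config V r \<omega> t u" if "u \<in> V - {r}" for u
    using that by (intro Suc.IH)
  moreover from this
  have "cycle_vertices V r (config V r (restrict \<omega> J) t) = cycle_vertices V r (config V r \<omega> t)"
    by (rule cycle_vertices_eqI)
  moreover have "(Suc t, v) \<in> J"
    using Suc.prems by auto
  ultimately show ?case
    using Suc.prems(1) by (simp del: restrict_apply add: restrict_apply')
qed auto

text \<open>Stated over an arbitrary space because the independence argument needs it on the product
  of the past coordinates alone.\<close>

lemma measurable_config':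
  assumes "finite V" "v \<in> V - {r}"
    and draw: "\<And>s u. s \<le> t \<Longrightarrow> u \<in> V - {r} \<Longrightarrow> (\<lambda>\<omega>. \<omega> (s, u)) \<in> measurable M (count_space UNIV)"
  shows "(\<lambda>\<omega>. config V r \<omega> t v) \<in> measurable M (count_space UNIV)"
  using assms(2) draw
proof (induction t arbitrary: v)
  case (Suc t)
  have IH: "(\<lambda>\<omega>. config V r \<omega> t u) \<in> measurable M (count_space UNIV)" if "u \<in> V - {r}" for u
    using that Suc.prems(2) by (intro Suc.IH) auto
  have "(\<lambda>\<omega>. cycle_vertices V r (config V r \<omega> t)) \<in> measurable M (count_space UNIV)"
    using assms(1) IH by (rule measurable_cycle_vertices)
  then have "(\<lambda>\<omega>. cycle_vertices V r (config V r \<omega> t)) -` {S. v \<in> S} \<inter> space M \<in> sets M"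
    by (rule measurable_sets) simp
  then have "{\<omega> \<in> space M. v \<in> cycle_vertices V r (config V r \<omega> t)} \<in> sets M"
    by (auto simp: vimage_def Int_def conj_commute)
  with Suc.prems IH[OF Suc.prems(1)] show ?case
    unfolding config.simps by (intro measurable_If) auto
qed auto

text \<open>Carries almost sure properties of all draws over to configurations.\<close>

lemma config_eq_draw: "\<exists>s. config V r \<omega> t v = \<omega> (s, v)"
  by (induction t) auto

text \<open>The joint law of the coordinates is the product measure itself, hence the product of
  their marginal laws.\<close>

lemma indep_vars_PiM_coordinates:
  assumes "\<And>i. i \<in> I \<Longrightarrow> prob_space (N i)" "I \<noteq> {}"
  shows "prob_space.indep_vars (PiM I N) N (\<lambda>i \<omega>. \<omega> i) I"
proof -
  interpret prob_space "PiM I N"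
    using assms(1) by (rule prob_space_PiM)
  have "distr (PiM I N) (PiM I N) (\<lambda>\<omega>. \<lambda>i\<in>I. \<omega> i) = distr (PiM I N) (PiM I N) (\<lambda>\<omega>. \<omega>)"
    by (intro distr_cong) (auto simp: space_PiM)
  also have "\<dots> = PiM I (\<lambda>i. distr (PiM I N) (N i) (\<lambda>\<omega>. \<omega> i))"
    using assms(1) by (simp add: distr_id2 distr_PiM_component cong: PiM_cong)
  finally show ?thesis
    using assms(2) by (subst indep_vars_iff_distr_eq_PiM') auto
qed

section \<open>Hitting times\<close>

text \<open>Used to cancel the flow that stays inside a set of vertices.\<close>

lemma sum_antisym_eq_0:
  fixes g :: "'a \<Rightarrow> 'a \<Rightarrow> real"
  assumes "\<And>x y. g x y = - g y x"
  shows "(\<Sum>x\<in>S. \<Sum>y\<in>S. g x y) = 0"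
proof -
  have "(\<Sum>x\<in>S. \<Sum>y\<in>S. g x y) = (\<Sum>x\<in>S. \<Sum>y\<in>S. g y x)"
    by (rule sum.swap)
  also have "\<dots> = - (\<Sum>x\<in>S. \<Sum>y\<in>S. g x y)"
    by (subst assms) (simp add: sum_negf)
  finally show ?thesis by simp
qed

locale rooted_network =
  fixes V :: "'a set" and E :: "'a set set" and w :: "'a set \<Rightarrow> real" and r :: 'a
  assumes graph: "simple_graph V E"
    and conn: "connected_graph V E"
    and root: "r \<in> V"
    and weight_pos: "\<And>e. e \<in> E \<Longrightarrow> w e > 0"
begin

text \<open>Conductances, extended by zero to non-edges so that all sums can run over
  \<open>V\<close>.\<close>

definition cond :: "'a \<Rightarrow> 'a \<Rightarrow> real" where
  "cond u v = (if {u, v} \<in> E then w {u, v} else 0)"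

definition wdeg :: "'a \<Rightarrow> real" where
  "wdeg v = (\<Sum>u\<in>V. cond u v)"

lemma finite_V: "finite V"
  using graph by (simp add: simple_graph_def)

lemma finite_E: "finite E"
  by (rule finite_subset[of _ "Pow V"]) (use graph in \<open>auto simp: simple_graph_def\<close>)

lemma edge_in_V: "{u, v} \<in> E \<Longrightarrow> u \<in> V \<and> v \<in> V"
  using graph by (auto simp: simple_graph_def)

lemma cond_commute: "cond u v = cond v u"
  by (simp add: cond_def insert_commute)

lemma cond_nonneg: "cond u v \<ge> 0"
  using weight_pos by (simp add: cond_def less_imp_le)

lemma wdeg_nonneg: "wdeg v \<ge> 0"
  unfolding wdeg_def by (intro sum_nonneg cond_nonneg)

lemma sum_neighbours: "(\<Sum>u\<in>neighbours E v. w {u, v} * f u) = (\<Sum>u\<in>V. cond u v * f u)"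
  by (rule sum.mono_neutral_cong_left)
    (use finite_V edge_in_V in \<open>auto simp: neighbours_def cond_def\<close>)

lemma wdeg_neighbours: "wdeg v = (\<Sum>u\<in>neighbours E v. w {u, v})"
  using sum_neighbours[of v "\<lambda>_. 1"] by (simp add: wdeg_def)

lemma sum_wdeg: "(\<Sum>v\<in>V. wdeg v) = 2 * (\<Sum>e\<in>E. w e)"
proof -
  have "(\<Sum>v\<in>V. wdeg v) = (\<Sum>(v, u)\<in>V \<times> V. cond v u)"
    unfolding sum.cartesian_product[symmetric] wdeg_def by (intro sum.cong refl cond_commute)
  also have "\<dots> = (\<Sum>(v, u)\<in>{(v, u). {v, u} \<in> E}. w {v, u})"
    by (rule sum.mono_neutral_cong_right)
      (use finite_V edge_in_V in \<open>auto simp: cond_def split: if_splits\<close>)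
  \<comment> \<open>The ordered pair \<open>(v, u)\<close> corresponds to the edge with
    \<open>v\<close> as marked end; \<open>THE\<close> recovers the other end. Each edge is thus
    counted once per end.\<close>
  also have "\<dots> = (\<Sum>(e, v)\<in>(SIGMA e:E. e). w e)"
  proof (rule sum.reindex_bij_witness[where j = "\<lambda>(v, u). ({v, u}, v)"
        and i = "\<lambda>(e, v). (v, THE u. e = {v, u})"])
    fix a assume a: "a \<in> (SIGMA e:E. e)"
    then obtain e v where ev: "a = (e, v)" "e \<in> E" "v \<in> e" by auto
    then have "card e = 2" using graph by (auto simp: simple_graph_def)
    then obtain u where u: "e = {v, u}"
      using ev(3) by (auto simp: card_2_iff)
    have "(THE x. e = {v, x}) = u"
      unfolding u by (rule the_equality) (auto simp: doubleton_eq_iff)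
    with ev u show "(\<lambda>(v, u). ({v, u}, v)) ((\<lambda>(e, v). (v, THE u. e = {v, u})) a) = a"
      and "(\<lambda>(e, v). (v, THE u. e = {v, u})) a \<in> {(v, u). {v, u} \<in> E}"
      by auto
  next
    fix a assume a: "a \<in> {(v, u). {v, u} \<in> E}"
    then obtain v u where vu: "a = (v, u)" "{v, u} \<in> E" by auto
    have "(THE x. {v, u} = {v, x}) = u"
      by (rule the_equality) (auto simp: doubleton_eq_iff)
    with vu show "(\<lambda>(e, v). (v, THE u. e = {v, u})) ((\<lambda>(v, u). ({v, u}, v)) a) = a"
      by simp
  qed auto
  also have "\<dots> = (\<Sum>e\<in>E. \<Sum>v\<in>e. w e)"
    using finite_E graph finite_V
    by (intro sum.Sigma[symmetric]) (auto simp: simple_graph_def intro: finite_subset)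
  also have "\<dots> = (\<Sum>e\<in>E. 2 * w e)"
    using graph by (intro sum.cong) (auto simp: simple_graph_def)
  finally show ?thesis by (simp add: sum_distrib_left)
qed

text \<open>Connectedness as induction along a path from \<open>r\<close>. The path lives in the
  symmetrised digraph, whose arcs in either direction are still edges.\<close>

lemma root_induct [consumes 1, case_names root edge]:
  assumes "v \<in> V" "P r" "\<And>u v. {u, v} \<in> E \<Longrightarrow> P u \<Longrightarrow> P v"
  shows "P v"
proof -
  let ?G = "with_proj (mk_symmetric (with_proj (sym_digraph_of V E)))"
  have "r \<rightarrow>\<^sup>*\<^bsub>?G\<^esub> v"
    using conn root assms(1)
    by (auto simp: connected_graph_def Digraph_Component.connected_def strongly_connected_def
        sym_digraph_of_def)
  then have "(r, v) \<in> (arcs_ends ?G)\<^sup>*"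
    by (rule reachable_rtranclI)
  then show ?thesis
    by (induction rule: rtrancl_induct)
      (use assms(2,3) in \<open>auto simp: arcs_ends_conv parcs_mk_symmetric sym_digraph_of_def insert_commute\<close>)
qed

text \<open>Ensures that the masses in \<open>neighbour_pmf\<close> sum to one at every non-root
  vertex. The root may be isolated, namely when it is the only vertex.\<close>

lemma neighbours_nonempty:
  assumes "v \<in> V - {r}"
  shows "neighbours E v \<noteq> {}"
proof -
  have "v \<in> V" using assms by simp
  then have "v = r \<or> neighbours E v \<noteq> {}"
    by (induction rule: root_induct) (auto simp: neighbours_def)
  with assms show ?thesis by auto
qed

lemma wdeg_pos:
  assumes "v \<in> V - {r}"
  shows "wdeg v > 0"
  unfolding wdeg_neighbours
  by (rule sum_pos) (use neighbours_nonempty[OF assms] finite_subset[OF _ finite_V, of "neighbours E v"]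
      edge_in_V weight_pos in \<open>auto simp: neighbours_def\<close>)

section \<open>Flow through a single edge\<close>

lemma flow_edge_bound:
  assumes min: "\<And>x. x \<in> V \<Longrightarrow> f r \<le> f x"
    and source: "\<And>x. x \<in> V - {r} \<Longrightarrow> (\<Sum>y\<in>V. cond x y * (f x - f y)) \<le> wdeg x"
    and edge: "{u, v} \<in> E"
  shows "(f v - f u) * w {u, v} \<le> (\<Sum>x\<in>V. wdeg x)"
proof (cases "f u < f v")
  case False
  then have "(f v - f u) * w {u, v} \<le> 0"
    using weight_pos[OF edge] by (simp add: mult_nonpos_nonneg)
  also have "\<dots> \<le> (\<Sum>x\<in>V. wdeg x)"
    by (intro sum_nonneg wdeg_nonneg)
  finally show ?thesis .
next
  case True
  \<comment> \<open>This superlevel set contains \<open>v\<close> but not \<open>u\<close>, and not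
    \<open>r\<close> because \<open>f r \<le> f u < f v\<close>. All flow across its boundary points
    outwards.\<close>
  define S where "S = {x\<in>V. f v \<le> f x}"
  define g where "g x y = cond x y * (f x - f y)" for x y
  have uv: "u \<in> V - S" "v \<in> S"
    using True edge_in_V[OF edge] by (auto simp: S_def)
  have S: "S \<subseteq> V - {r}"
    using min[of u] True uv by (auto simp: S_def)
  then have finS: "finite S"
    using finite_V finite_subset by blast
  have g_nonneg: "g x y \<ge> 0" if "x \<in> S" "y \<in> V - S" for x y
    using that cond_nonneg[of x y] by (auto simp: g_def S_def)
  have "(f v - f u) * w {u, v} = g v u"
    using edge by (simp add: g_def cond_def insert_commute)
  also have "\<dots> \<le> (\<Sum>y\<in>V-S. g v y)"
    using uv g_nonneg finite_V by (intro member_le_sum) auto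
  also have "\<dots> \<le> (\<Sum>x\<in>S. \<Sum>y\<in>V-S. g x y)"
    using uv g_nonneg finS
    by (intro member_le_sum[where f = "\<lambda>x. \<Sum>y\<in>V-S. g x y"]) (auto intro!: sum_nonneg)
  \<comment> \<open>Adding the internal flow, which is zero, turns the boundary flow into a sum of
    net outflows, to which \<open>source\<close> applies.\<close>
  also have "\<dots> = (\<Sum>x\<in>S. \<Sum>y\<in>S. g x y) + (\<Sum>x\<in>S. \<Sum>y\<in>V-S. g x y)"
    by (subst sum_antisym_eq_0) (auto simp: g_def cond_commute algebra_simps)
  also have "\<dots> = (\<Sum>x\<in>S. \<Sum>y\<in>V. g x y)"
    unfolding sum.distrib[symmetric]
    using S finite_V by (intro sum.cong refl) (subst (3) sum.subset_diff[of S], auto)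
  also have "\<dots> \<le> (\<Sum>x\<in>S. wdeg x)"
    unfolding g_def using S by (intro sum_mono source) auto
  also have "\<dots> \<le> (\<Sum>x\<in>V. wdeg x)"
    using S finite_V by (intro sum_mono2) (auto simp: wdeg_nonneg)
  finally show ?thesis .
qed

text \<open>The expectation of the minimum of \<open>k\<close> and the hitting time of \<open>r\<close>.\<close>

primrec trunc_hit :: "nat \<Rightarrow> 'a \<Rightarrow> real" where
  "trunc_hit 0 v = 0"
| "trunc_hit (Suc k) v =
     (if v \<in> V - {r} then 1 + (\<Sum>u\<in>V. cond u v * trunc_hit k u) / wdeg v else 0)"

lemma trunc_hit_outside: "v \<notin> V - {r} \<Longrightarrow> trunc_hit k v = 0"
  by (induction k) auto

lemma trunc_hit_mono: "trunc_hit k v \<le> trunc_hit (Suc k) v"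
proof (induction k arbitrary: v)
  case 0
  then show ?case by simp
next
  case (Suc k)
  have "(\<Sum>u\<in>V. cond u v * trunc_hit k u) / wdeg v
      \<le> (\<Sum>u\<in>V. cond u v * trunc_hit (Suc k) u) / wdeg v"
    by (intro divide_right_mono sum_mono mult_left_mono Suc.IH cond_nonneg wdeg_nonneg)
  then show ?case
    by (subst (1 2) trunc_hit.simps(2)) simp
qed

lemma incseq_trunc_hit: "incseq (\<lambda>k. trunc_hit k v)"
  using trunc_hit_mono by (rule incseq_SucI)

lemma trunc_hit_nonneg: "trunc_hit k v \<ge> 0"
  using incseqD[OF incseq_trunc_hit, of 0 k v] by simp

text \<open>The recursion gives equality with \<open>Suc k\<close> at \<open>x\<close> and
  \<open>k\<close> at its neighbours; lowering \<open>Suc k\<close> to \<open>k\<close> at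
  \<open>x\<close> leaves an inequality. This is why \<open>flow_edge_bound\<close> assumes only an
  inequality.\<close>

lemma trunc_hit_source:
  assumes "x \<in> V - {r}"
  shows "(\<Sum>y\<in>V. cond x y * (trunc_hit k x - trunc_hit k y)) \<le> wdeg x"
proof -
  have "wdeg x * trunc_hit (Suc k) x = wdeg x + (\<Sum>y\<in>V. cond y x * trunc_hit k y)"
    using wdeg_pos[OF assms] assms by (simp add: field_simps)
  moreover have "wdeg x * trunc_hit k x \<le> wdeg x * trunc_hit (Suc k) x"
    by (intro mult_left_mono trunc_hit_mono wdeg_nonneg)
  ultimately show ?thesis
    by (simp add: right_diff_distrib sum_subtractf wdeg_def cond_commute[of x]
        flip: sum_distrib_right)
qed

text \<open>The flow bound applies since truncated times are nonnegative and vanish at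
  \<open>r\<close>. What matters is that the bound does not depend on \<open>k\<close>.\<close>

lemma trunc_hit_edge:
  assumes "{u, v} \<in> E"
  shows "trunc_hit k v - trunc_hit k u \<le> 2 * (\<Sum>e\<in>E. w e) / w {u, v}"
  using flow_edge_bound[of "trunc_hit k", OF _ trunc_hit_source assms] weight_pos[OF assms]
  by (simp add: trunc_hit_outside[of r] trunc_hit_nonneg sum_wdeg field_simps)

text \<open>Adding up the edge bounds along a path from \<open>r\<close> shows that hitting times
  are finite, with no analysis of the random walk.\<close>

lemma trunc_hit_bounded: "\<exists>B. \<forall>k. trunc_hit k v \<le> B"
proof (cases "v \<in> V")
  case True
  then show ?thesis
  proof (induction rule: root_induct)
    case root
    then show ?case using trunc_hit_outside[of r] by auto
  next
    case (edge u v)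
    then obtain B where "trunc_hit k u \<le> B" for k by auto
    then have "trunc_hit k v \<le> B + 2 * (\<Sum>e\<in>E. w e) / w {u, v}" for k
      using trunc_hit_edge[OF edge(1), of k] by (smt (verit))
    then show ?case by blast
  qed
next
  case False
  then show ?thesis using trunc_hit_outside[of v] by auto
qed

text \<open>\<open>lim\<close> is meaningful here because the truncated times are increasing and
  bounded.\<close>

definition hit :: "'a \<Rightarrow> real" where
  "hit v = lim (\<lambda>k. trunc_hit k v)"

lemma trunc_hit_tendsto: "(\<lambda>k. trunc_hit k v) \<longlonglongrightarrow> hit v"
proof -
  from trunc_hit_bounded obtain B where "\<forall>k. trunc_hit k v \<le> B" by blast
  then have "convergent (\<lambda>k. trunc_hit k v)"
    using incseq_convergent[OF incseq_trunc_hit] convergentI by metis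
  then show ?thesis
    by (simp add: hit_def convergent_LIMSEQ_iff)
qed

lemma hit_outside: "v \<notin> V - {r} \<Longrightarrow> hit v = 0"
  using trunc_hit_tendsto[of v] LIMSEQ_unique[OF _ tendsto_const, of "\<lambda>_. 0"]
  by (simp add: trunc_hit_outside LIMSEQ_const_iff)

lemma hit_equation:
  assumes "v \<in> V - {r}"
  shows "hit v = 1 + (\<Sum>u\<in>V. cond u v * hit u) / wdeg v"
proof (rule LIMSEQ_unique)
  show "(\<lambda>k. trunc_hit (Suc k) v) \<longlonglongrightarrow> hit v"
    using trunc_hit_tendsto by (rule LIMSEQ_Suc)
  have "(\<lambda>k. 1 + (\<Sum>u\<in>V. cond u v * trunc_hit k u) / wdeg v)
      \<longlonglongrightarrow> 1 + (\<Sum>u\<in>V. cond u v * hit u) / wdeg v"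
    using wdeg_pos[OF assms] by (intro tendsto_intros trunc_hit_tendsto) simp
  then show "(\<lambda>k. trunc_hit (Suc k) v) \<longlonglongrightarrow> 1 + (\<Sum>u\<in>V. cond u v * hit u) / wdeg v"
    using assms by simp
qed

section \<open>Edge differences and one-step means of hitting times\<close>

lemma weight_ratio_ge:
  assumes "e \<in> E" "e' \<in> E"
  shows "w e / w e' \<le> weight_ratio E w"
  unfolding weight_ratio_def
proof (rule Max_ge)
  show "finite {w e / w e' | e e'. e \<in> E \<and> e' \<in> E}"
    by (rule finite_subset[of _ "(\<lambda>(e, e'). w e / w e') ` (E \<times> E)"]) (use finite_E in auto)
qed (use assms in auto)

text \<open>The uniform edge bound survives the limit, and the total weight divided by one edge
  weight is at most \<open>weight_ratio E w\<close> per edge.\<close>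

lemma hit_edge:
  assumes "{u, v} \<in> E"
  shows "hit v - hit u \<le> 2 * weight_ratio E w * card E"
proof -
  have "hit v - hit u \<le> 2 * (\<Sum>e\<in>E. w e) / w {u, v}"
    by (rule LIMSEQ_le_const2[OF tendsto_diff[OF trunc_hit_tendsto trunc_hit_tendsto]])
      (use trunc_hit_edge[OF assms] in auto)
  also have "\<dots> = 2 * (\<Sum>e\<in>E. w e / w {u, v})"
    by (simp flip: sum_divide_distrib)
  also have "\<dots> \<le> 2 * (\<Sum>e\<in>E. weight_ratio E w)"
    using assms by (intro mult_left_mono sum_mono weight_ratio_ge) auto
  finally show ?thesis by (simp add: mult_ac)
qed

lemma set_pmf_neighbour:
  assumes "v \<in> V - {r}"
  shows "set_pmf (neighbour_pmf E w v) \<subseteq> neighbours E v"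
  using pmf_neighbour_pmf[OF graph weight_pos neighbours_nonempty[OF assms]]
  by (auto simp: set_pmf_iff split: if_splits)

text \<open>Each fresh draw \<open>\<sigma> v\<close> thus contributes
  \<open>hit v - hit (\<sigma> v)\<close> with mean exactly one, which lets the potential count
  draws.\<close>

lemma expectation_hit:
  assumes "v \<in> V - {r}"
  shows "measure_pmf.expectation (neighbour_pmf E w v) hit = hit v - 1"
proof -
  have fin: "finite (neighbours E v)"
    by (rule finite_subset[OF _ finite_V]) (use edge_in_V in \<open>auto simp: neighbours_def\<close>)
  have "measure_pmf.expectation (neighbour_pmf E w v) hit =
      (\<Sum>u\<in>neighbours E v. hit u * pmf (neighbour_pmf E w v) u)"
    using set_pmf_neighbour[OF assms] by (intro integral_measure_pmf_real fin) auto
  also have "\<dots> = (\<Sum>u\<in>neighbours E v. w {u, v} * hit u / wdeg v)"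
    by (intro sum.cong refl)
      (simp add: pmf_neighbour_pmf[OF graph weight_pos neighbours_nonempty[OF assms]] wdeg_neighbours)
  also have "\<dots> = hit v - 1"
    by (subst hit_equation[OF assms]) (simp add: sum_neighbours flip: sum_divide_distrib)
  finally show ?thesis .
qed

text \<open>Gives integrability of \<open>hit\<close> at any random point, including values outside
  \<open>V\<close>, where \<open>hit\<close> is zero.\<close>

lemma hit_bounded: "\<exists>B. \<forall>x. \<bar>hit x\<bar> \<le> B"
proof (intro exI allI)
  fix x show "\<bar>hit x\<bar> \<le> (\<Sum>v\<in>V. \<bar>hit v\<bar>)"
  proof (cases "x \<in> V")
    case True
    then show ?thesis using finite_V by (intro member_le_sum) auto
  qed (simp add: hit_outside sum_nonneg)
qed

section \<open>The potential along a run\<close>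

abbreviation "draws \<equiv> draw_space V E w r"

abbreviation on_cycle :: "(nat \<times> 'a \<Rightarrow> 'a) \<Rightarrow> nat \<Rightarrow> 'a set" where
  "on_cycle \<omega> t \<equiv> cycle_vertices V r (config V r \<omega> t)"

definition potential :: "('a \<Rightarrow> 'a) \<Rightarrow> real" where
  "potential \<sigma> = (\<Sum>v\<in>V - {r}. hit v - hit (\<sigma> v))"

sublocale prob_space draws
  by (rule prob_space_draw_space)

lemma prob_space_draw: "prob_space (case i of (t, v) \<Rightarrow> measure_pmf (neighbour_pmf E w v))"
  by (simp add: measure_pmf.prob_space_axioms split: prod.splits)

lemma measurable_draw:
  assumes "v \<in> V - {r}"
  shows "(\<lambda>\<omega>. \<omega> (t, v)) \<in> measurable draws (count_space UNIV)"
proof -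
  have "(\<lambda>\<omega>. \<omega> (t, v)) \<in> measurable draws (measure_pmf (neighbour_pmf E w v))"
    unfolding draw_space_def
    using measurable_component_singleton[of "(t, v)" "UNIV \<times> (V - {r})"
        "\<lambda>(t, v). measure_pmf (neighbour_pmf E w v)"] assms by simp
  then show ?thesis by simp
qed

lemma distr_draw:
  assumes "v \<in> V - {r}"
  shows "distr draws (measure_pmf (neighbour_pmf E w v)) (\<lambda>\<omega>. \<omega> (t, v)) =
    measure_pmf (neighbour_pmf E w v)"
  unfolding draw_space_def
  using distr_PiM_component[of "UNIV \<times> (V - {r})"
      "\<lambda>(t, v). measure_pmf (neighbour_pmf E w v)" "(t, v)", OF prob_space_draw] assms by simp

lemma expectation_draw:
  fixes f :: "'a \<Rightarrow> real"
  assumes "v \<in> V - {r}"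
  shows "expectation (\<lambda>\<omega>. f (\<omega> (t, v))) = measure_pmf.expectation (neighbour_pmf E w v) f"
proof -
  have "integral\<^sup>L (distr draws (measure_pmf (neighbour_pmf E w v)) (\<lambda>\<omega>. \<omega> (t, v))) f =
      expectation (\<lambda>\<omega>. f (\<omega> (t, v)))"
    using measurable_draw[OF assms] by (intro integral_distr) auto
  then show ?thesis
    by (simp only: distr_draw[OF assms])
qed

lemma AE_draw:
  assumes "v \<in> V - {r}"
  shows "AE \<omega> in draws. {\<omega> (t, v), v} \<in> E"
proof -
  have "AE u in distr draws (measure_pmf (neighbour_pmf E w v)) (\<lambda>\<omega>. \<omega> (t, v)). {u, v} \<in> E"
    unfolding distr_draw[OF assms]
    using set_pmf_neighbour[OF assms] by (auto simp: AE_measure_pmf_iff neighbours_def)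
  then show ?thesis
    by (rule AE_distrD[rotated]) (use measurable_draw[OF assms] in simp)
qed

lemma measurable_on_cycle:
  "(\<lambda>\<omega>. on_cycle \<omega> t) \<in> measurable draws (count_space UNIV)"
  by (intro measurable_cycle_vertices finite_V measurable_config)

lemma integrable_hit:
  assumes "X \<in> measurable draws (count_space UNIV)"
  shows "integrable draws (\<lambda>\<omega>. hit (X \<omega>))"
proof -
  obtain B where "\<forall>x. \<bar>hit x\<bar> \<le> B" using hit_bounded by blast
  then show ?thesis
    by (intro integrable_const_bound[where B = B] measurable_compose[OF assms]) auto
qed

lemma integrable_indicator_cycle:
  "integrable draws (\<lambda>\<omega>. indicator (on_cycle \<omega> t) v :: real)"
proof (rule integrable_const_bound[where B = 1])
  show "(\<lambda>\<omega>. indicator (on_cycle \<omega> t) v :: real) \<in> borel_measurable draws"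
    by (rule measurable_compose[OF measurable_on_cycle]) simp
qed (auto simp: indicator_def)

text \<open>Whether \<open>v\<close> is popped after round \<open>t\<close> is a function of the
  coordinates in \<open>A\<close>; its next value is the coordinate in \<open>B\<close>. These index
  sets are disjoint.\<close>

lemma indep_cycle_draw:
  assumes v: "v \<in> V - {r}"
  shows "indep_var borel (\<lambda>\<omega>. indicator (on_cycle \<omega> t) v :: real)
    borel (\<lambda>\<omega>. hit v - hit (\<omega> (Suc t, v)))"
proof -
  define I where "I = (UNIV :: nat set) \<times> (V - {r})"
  define N where "N = (\<lambda>(t :: nat, v). measure_pmf (neighbour_pmf E w v))"
  define A where "A = {..t} \<times> (V - {r})"
  define B where "B = {(Suc t, v)}"
  have N: "prob_space (N i)" for i
    unfolding N_def by (rule prob_space_draw)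
  have "indep_vars N (\<lambda>i \<omega>. \<omega> i) I"
    using indep_vars_PiM_coordinates[of I N] N v by (auto simp: draw_space_def I_def N_def)
  then have ind: "indep_var (PiM A N) (\<lambda>\<omega>. restrict \<omega> A) (PiM B N) (\<lambda>\<omega>. restrict \<omega> B)"
    by (rule indep_var_restrict) (use v in \<open>auto simp: A_def B_def I_def\<close>)
  have coord: "(\<lambda>\<omega>. \<omega> (s, u)) \<in> measurable (PiM J N) (count_space UNIV)" if "(s, u) \<in> J" for s u J
    using measurable_component_singleton[OF that, of N] by (simp add: N_def)
  have past: "(\<lambda>\<omega>. indicator (on_cycle \<omega> t) v :: real) \<in> borel_measurable (PiM A N)"
    by (rule measurable_compose[of _ _ "count_space UNIV"],
        intro measurable_cycle_vertices finite_V measurable_config' coord) (auto simp: A_def)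
  have fresh: "(\<lambda>\<omega>. hit v - hit (\<omega> (Suc t, v))) \<in> borel_measurable (PiM B N)"
    by (rule measurable_compose[OF coord]) (auto simp: B_def)
  have "on_cycle (restrict \<omega> A) t = on_cycle \<omega> t" for \<omega>
    by (intro cycle_vertices_eqI config_restrict) (auto simp: A_def)
  then show ?thesis
    using indep_var_compose[OF ind past fresh] by (simp add: o_def B_def)
qed

text \<open>By independence the mean of the product factors, and the second factor has mean
  one.\<close>

lemma expectation_redraw:
  assumes v: "v \<in> V - {r}"
  shows "expectation (\<lambda>\<omega>. indicator (on_cycle \<omega> t) v * (hit v - hit (\<omega> (Suc t, v)))) =
      expectation (\<lambda>\<omega>. indicator (on_cycle \<omega> t) v)"
    and "integrable draws (\<lambda>\<omega>. indicator (on_cycle \<omega> t) v * (hit v - hit (\<omega> (Suc t, v))))"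
proof -
  have int: "integrable draws (\<lambda>\<omega>. hit (\<omega> (Suc t, v)))"
    by (intro integrable_hit measurable_draw v)
  then have "expectation (\<lambda>\<omega>. hit v - hit (\<omega> (Suc t, v))) = 1"
    using expectation_hit[OF v] by (simp add: expectation_draw[OF v] prob_space)
  then show "expectation (\<lambda>\<omega>. indicator (on_cycle \<omega> t) v * (hit v - hit (\<omega> (Suc t, v)))) =
      expectation (\<lambda>\<omega>. indicator (on_cycle \<omega> t) v)"
    using int by (subst indep_var_lebesgue_integral[OF indep_cycle_draw[OF v]
          integrable_indicator_cycle]) auto
  show "integrable draws (\<lambda>\<omega>. indicator (on_cycle \<omega> t) v * (hit v - hit (\<omega> (Suc t, v))))"
    using int by (intro indep_var_integrable[OF indep_cycle_draw[OF v] integrable_indicator_cycle])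
      auto
qed

lemma card_on_cycle: "real (card (on_cycle \<omega> t)) = (\<Sum>v\<in>V - {r}. indicator (on_cycle \<omega> t) v)"
  using finite_V cycle_vertices_subset[of V r "config V r \<omega> t"]
  by (simp add: indicator_def sum.If_cases Int_absorb1 Int_absorb2)

text \<open>The popped vertices lose their old contributions, which total zero by
  \<open>sum_cycle_vertices\<close>, so only the new ones appear.\<close>

lemma potential_config_Suc:
  "potential (config V r \<omega> (Suc t)) = potential (config V r \<omega> t) +
    (\<Sum>v\<in>V - {r}. indicator (on_cycle \<omega> t) v * (hit v - hit (\<omega> (Suc t, v))))"
proof -
  let ?C = "on_cycle \<omega> t" and ?\<sigma> = "config V r \<omega> t"
  have "potential (config V r \<omega> (Suc t)) = (\<Sum>v\<in>V - {r}. (hit v - hit (?\<sigma> v))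
      + indicator ?C v * (hit v - hit (\<omega> (Suc t, v))) - indicator ?C v * (hit v - hit (?\<sigma> v)))"
    unfolding potential_def by (intro sum.cong) (auto simp: indicator_def)
  also have "\<dots> = potential ?\<sigma> + (\<Sum>v\<in>V - {r}. indicator ?C v * (hit v - hit (\<omega> (Suc t, v))))
      - (\<Sum>v\<in>V - {r}. indicator ?C v * (hit v - hit (?\<sigma> v)))"
    by (simp add: sum.distrib sum_subtractf potential_def)
  also have "(\<Sum>v\<in>V - {r}. indicator ?C v * (hit v - hit (?\<sigma> v))) = (\<Sum>v\<in>?C. hit v - hit (?\<sigma> v))"
    by (rule sum.mono_neutral_cong_right)
      (use finite_V cycle_vertices_subset[of V r ?\<sigma>] in auto)
  also have "\<dots> = 0"
    by (rule sum_cycle_vertices[OF finite_V])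
  finally show ?thesis by simp
qed

lemma expectation_potential:
  "integrable draws (\<lambda>\<omega>. potential (config V r \<omega> t)) \<and>
   expectation (\<lambda>\<omega>. potential (config V r \<omega> t)) =
     (\<Sum>s\<le>t. expectation (\<lambda>\<omega>. real (card (drawn_vertices V r \<omega> s))))"
proof (induction t)
  \<comment> \<open>Round 0 draws every non-root vertex, with mean contribution one each, so the
    initial draws are counted.\<close>
  case 0
  have "integrable draws (\<lambda>\<omega>. hit (\<omega> (0, v)))" if "v \<in> V - {r}" for v
    by (intro integrable_hit measurable_draw that)
  then show ?case
    by (auto simp: potential_def expectation_draw expectation_hit prob_space
        intro!: Bochner_Integration.integrable_sum Bochner_Integration.integrable_diff)
next
  case (Suc t)
  have int: "integrable draws (\<lambda>\<omega>. \<Sum>v\<in>V - {r}.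
      indicator (on_cycle \<omega> t) v * (hit v - hit (\<omega> (Suc t, v))))"
    by (intro Bochner_Integration.integrable_sum expectation_redraw(2))
  have "expectation (\<lambda>\<omega>. real (card (on_cycle \<omega> t))) =
      (\<Sum>v\<in>V - {r}. expectation (\<lambda>\<omega>. indicator (on_cycle \<omega> t) v))"
    unfolding card_on_cycle by (intro Bochner_Integration.integral_sum integrable_indicator_cycle)
  also have "\<dots> = expectation (\<lambda>\<omega>. \<Sum>v\<in>V - {r}.
      indicator (on_cycle \<omega> t) v * (hit v - hit (\<omega> (Suc t, v))))"
    by (subst Bochner_Integration.integral_sum) (auto simp: expectation_redraw)
  finally show ?case
    unfolding potential_config_Suc using Suc.IH int
    by (simp del: Bochner_Integration.integral_sum Bochner_Integration.integral_sum')
qed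

section \<open>Bounding the expected number of draws\<close>

lemma AE_potential_le:
  "AE \<omega> in draws. potential (config V r \<omega> t)
    \<le> (real (card V) - 1) * (2 * weight_ratio E w * card E)"
proof -
  \<comment> \<open>One null set serves all vertices and rounds, as there are only countably
    many.\<close>
  have "AE \<omega> in draws. \<forall>v\<in>V - {r}. \<forall>s. {\<omega> (s, v), v} \<in> E"
    using finite_V AE_draw by (subst AE_finite_all) (auto simp: AE_all_countable)
  then show ?thesis
  proof eventually_elim
    case (elim \<omega>)
    have "potential (config V r \<omega> t) \<le> (\<Sum>v\<in>V - {r}. 2 * weight_ratio E w * card E)"
      unfolding potential_def
    proof (intro sum_mono hit_edge)
      fix v assume "v \<in> V - {r}"
      with elim config_eq_draw[of V r \<omega> t v] show "{config V r \<omega> t v, v} \<in> E" by auto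
    qed
    moreover have "real (card (V - {r})) = real (card V) - 1"
      using finite_V root card_gt_0_iff[of V] by (subst card_Diff_singleton) auto
    ultimately show ?case by simp
  qed
qed

text \<open>The partial sums of expected draws are mean potentials, so the almost sure bound on the
  potential bounds the whole series.\<close>

lemma expected_draws_le:
  "expected_draws V E w r \<le> ennreal ((real (card V) - 1) * (2 * weight_ratio E w * card E))"
proof -
  let ?B = "(real (card V) - 1) * (2 * weight_ratio E w * card E)"
  let ?c = "\<lambda>s \<omega>. card (drawn_vertices V r \<omega> s)"
  have meas: "(\<lambda>\<omega>. drawn_vertices V r \<omega> s) \<in> measurable draws (count_space UNIV)" for s
    using measurable_on_cycle by (cases s) auto
  have borel: "(\<lambda>\<omega>. of_nat (?c s \<omega>) :: ennreal) \<in> borel_measurable draws" for s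
    by (rule measurable_compose[OF meas]) simp
  have int: "integrable draws (\<lambda>\<omega>. real (?c s \<omega>))" for s
    by (cases s) (auto simp: card_on_cycle intro: integrable_indicator_cycle)
  have "expected_draws V E w r = (\<Sum>s. \<integral>\<^sup>+ \<omega>. of_nat (?c s \<omega>) \<partial>draws)"
    unfolding expected_draws_def num_draws_def by (intro nn_integral_suminf borel)
  also have "\<dots> = (\<Sum>s. ennreal (expectation (\<lambda>\<omega>. real (?c s \<omega>))))"
    using nn_integral_eq_integral[OF int] by (simp add: ennreal_of_nat_eq_real_of_nat)
  also have "\<dots> \<le> ennreal ?B"
  proof (rule suminf_le_const)
    fix t
    \<comment> \<open>The extra term \<open>s = t\<close> matches the potential after round
      \<open>t\<close>.\<close>
    have "(\<Sum>s<t. expectation (\<lambda>\<omega>. real (?c s \<omega>))) \<le> (\<Sum>s\<le>t. expectation (\<lambda>\<omega>. real (?c s \<omega>)))"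
      by (intro sum_mono2) auto
    also have "\<dots> = expectation (\<lambda>\<omega>. potential (config V r \<omega> t))"
      by (simp add: expectation_potential)
    also have "\<dots> \<le> ?B"
      using expectation_potential[of t] AE_potential_le[of t] by (intro integral_le_const) auto
    finally show "(\<Sum>s<t. ennreal (expectation (\<lambda>\<omega>. real (?c s \<omega>)))) \<le> ennreal ?B"
      by (subst sum_ennreal) (auto intro: ennreal_leI)
  qed simp
  finally show ?thesis .
qed

text \<open>Without edges \<open>weight_ratio\<close> is unspecified, but the factor
  \<open>card E\<close> is then zero.\<close>

lemma weight_ratio_card_nonneg: "weight_ratio E w * card E \<ge> 0"
proof (cases "E = {}")
  case False
  then obtain e where e: "e \<in> E" by blast
  then have "w e / w e \<le> weight_ratio E w"
    by (intro weight_ratio_ge)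
  with weight_pos[OF e] show ?thesis by simp
qed simp

end

theorem theorem4p2:
  fixes V :: "'a set" and E :: "'a set set" and w :: "'a set \<Rightarrow> real" and r :: 'a
  assumes "simple_graph V E"
    and "connected_graph V E"
    and "r \<in> V"
    and "\<forall>e\<in>E. w e > 0"
  shows "expected_draws V E w r
    \<le> ennreal ((real (card V) - 1) + 2 * weight_ratio E w * real (card E) * real (card V))"
proof -
  interpret rooted_network V E w r
    using assms by unfold_locales auto
  have "real (card V) \<ge> 1"
    using finite_V root by (simp add: Suc_le_eq card_gt_0_iff) blast
  \<comment> \<open>The bound obtained already includes the initial draws; the claimed one exceeds
    it by \<open>card V - 1\<close> plus a nonnegative multiple of
    \<open>weight_ratio E w * card E\<close>.\<close>
  then have "(real (card V) - 1) * (2 * weight_ratio E w * card E)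
      \<le> (real (card V) - 1) + 2 * weight_ratio E w * real (card E) * real (card V)"
    using weight_ratio_card_nonneg by (simp add: algebra_simps)
  then show ?thesis
    using expected_draws_le by (meson ennreal_leI order_trans)
qed

end
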